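(* For integers $n\geqslant 0$ and $s\geqslant -1$, let $\mathfrak a_{n,s}$ be the number of sequences $\sigma\in\mathbb N^n$ with $\sigma_i<i+s$ for all $i\in\{1,\dots,n\}$ which avoid both $010$ and $102$. For $n,k\geqslant 0$, let $\mathfrak b_{n,k}$ be the number of words of length $n$ over $\{0,\dots,k-1\}$ avoiding $010$ and $102$ whose maximum letter is $k-1$. Then for all $n\geqslant 1$, $s\geqslant 0$, $$\mathfrak a_{n,s}=\sum_{z=0}^{n}\mathfrak a_{n-z,s+z-1}+\sum_{z=1}^{n-1}\mathfrak a_{n-z,s-1}+\sum_{r=1}^{n-2}\sum_{m=1}^{s}\mathfrak b_{r,m}\sum_{\ell=0}^{n-r-1}\big(n-r-\ell-\delta_{\ell,0}\big)\,\mathfrak a_{\ell,s-m-1},$$ where $\delta$ is the Kronecker delta.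
   Context: An integer sequence contains a pattern $\rho$ (a finite integer sequence such as $010$ or $102$) if it has a subsequence order-isomorphic to $\rho$, and avoids $\rho$ otherwise. Sequences $\sigma\in\mathbb N^n$ with $\sigma_i<i+s$ for all $i$ are called $s$-shifted inversion sequences; for $s=0$ these are the inversion sequences, so $\mathfrak a_{n,0}$ counts inversion sequences of size $n$ avoiding $010$ and $102$. For $s=-1$ the definition gives $\mathfrak a_{0,-1}=1$ and $\mathfrak a_{n,-1}=0$ for $n\geqslant1$. *)

theory Defs
  imports Main "HOL-Library.Sublist"
begin

definition order_isomorphic :: "'a::linorder list \<Rightarrow> 'b::linorder list \<Rightarrow> bool" where
  "order_isomorphic u v \<longleftrightarrow>
     length u = length v \<and>
     (\<forall>i<length u. \<forall>j<length u. u ! i < u ! j \<longleftrightarrow> v ! i < v ! j)"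

definition contains_pattern :: "'a::linorder list \<Rightarrow> 'b::linorder list \<Rightarrow> bool" where
  "contains_pattern \<sigma> \<rho> \<longleftrightarrow> (\<exists>\<tau>. subseq \<tau> \<sigma> \<and> order_isomorphic \<tau> \<rho>)"

definition avoids_pattern :: "'a::linorder list \<Rightarrow> 'b::linorder list \<Rightarrow> bool" where
  "avoids_pattern \<sigma> \<rho> \<longleftrightarrow> \<not> contains_pattern \<sigma> \<rho>"

(* Sequences are indexed from 1, lists from 0: the i-th entry of \<sigma> is \<sigma> ! (i - 1).
   The shift s is an integer because s = -1 occurs; the bound i + s must not be truncated. *)
definition shifted_inversion_sequences :: "nat \<Rightarrow> int \<Rightarrow> nat list set" where
  "shifted_inversion_sequences n s =
     {\<sigma>. length \<sigma> = n \<and> (\<forall>i\<in>{1..n}. int (\<sigma> ! (i - 1)) < int i + s)}"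

definition \<aa> :: "nat \<Rightarrow> int \<Rightarrow> nat" where
  "\<aa> n s = card {\<sigma> \<in> shifted_inversion_sequences n s.
     avoids_pattern \<sigma> [0, 1, 0 :: nat] \<and> avoids_pattern \<sigma> [1, 0, 2 :: nat]}"

(* The empty word has no maximum letter, so \<bb> 0 k = 0. *)
definition \<bb> :: "nat \<Rightarrow> nat \<Rightarrow> nat" where
  "\<bb> n k = card {w :: nat list. length w = n \<and> set w \<subseteq> {0..<k} \<and>
     avoids_pattern w [0, 1, 0 :: nat] \<and> avoids_pattern w [1, 0, 2 :: nat] \<and>
     w \<noteq> [] \<and> int (Max (set w)) = int k - 1}"

end

theory Submission
  imports Defs
begin

text \<open>
  A sequence avoiding 010 has its zeros in one block of some length \<open>z\<close>. If the block is initial or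
  empty, the rest is a positive sequence, which is lowered by 1. If it is final but not initial,
  the positive prefix is lowered by 1. Otherwise let \<open>m\<close> be the maximum after the block. Avoiding 102
  forces all earlier letters to be at least \<open>m\<close>, and avoiding 010 forces the earlier copies of \<open>m\<close> to
  stand just before the zeros, so the sequence is \<open>u' m\<^sup>j 0\<^sup>z v'\<close> with \<open>u' > m\<close> and \<open>0 < v' \<le> m\<close>.
  Lowering \<open>u'\<close> by \<open>m + 1\<close> and \<open>v'\<close> by 1 gives the triple sum. With \<open>r\<close> the length of \<open>v'\<close> and \<open>l\<close>
  that of \<open>u'\<close>, \<open>j + z = n - r - l\<close> has \<open>n - r - l\<close> solutions with \<open>z \<ge> 1\<close>, and \<open>j = l = 0\<close> is
  excluded because the block is not initial.
\<close>

section \<open>Avoidance of both patterns expressed by three-letter subsequences\<close>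

definition avoids_both :: "'a::linorder list \<Rightarrow> bool" where
  "avoids_both w \<longleftrightarrow>
     (\<forall>a b c. subseq [a, b, c] w \<longrightarrow> \<not> (a < b \<and> c = a) \<and> \<not> (b < a \<and> a < c))"

lemma all_less_3: "(\<forall>i<length [p, q, r]. P i) \<longleftrightarrow> P 0 \<and> P 1 \<and> P 2"
  by (auto simp: less_Suc_eq numeral_eq_Suc)

lemma order_isomorphic_3:
  "order_isomorphic [a, b, c] [p, q, r] \<longleftrightarrow>
       (a < b \<longleftrightarrow> p < q) \<and> (b < a \<longleftrightarrow> q < p) \<and> (a < c \<longleftrightarrow> p < r) \<and>
       (c < a \<longleftrightarrow> r < p) \<and> (b < c \<longleftrightarrow> q < r) \<and> (c < b \<longleftrightarrow> r < q)"
  unfolding order_isomorphic_def all_less_3 by auto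

lemma contains_pattern_3:
  "contains_pattern w [p, q, r] \<longleftrightarrow>
     (\<exists>a b c. subseq [a, b, c] w \<and> order_isomorphic [a, b, c] [p, q, r])"
proof
  assume "contains_pattern w [p, q, r]"
  then obtain t where t: "subseq t w" "order_isomorphic t [p, q, r]"
    by (auto simp: contains_pattern_def)
  moreover from t obtain a b c where "t = [a, b, c]"
    by (auto simp: order_isomorphic_def length_Suc_conv)
  ultimately show "\<exists>a b c. subseq [a, b, c] w \<and> order_isomorphic [a, b, c] [p, q, r]"
    by blast
qed (auto simp: contains_pattern_def)

text \<open>A triple \<open>[a, b, c]\<close> has the shape 010 exactly when \<open>a < b\<close>
  and \<open>c = a\<close>, and the shape 102 exactly when \<open>b < a\<close> and
  \<open>a < c\<close>. The comparison of \<open>b\<close> with \<open>c\<close> then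
  follows.\<close>

lemma avoids_both_iff:
  "avoids_both w \<longleftrightarrow>
     avoids_pattern w [0, 1, 0 :: nat] \<and> avoids_pattern w [1, 0, 2 :: nat]"
proof -
  have "order_isomorphic [a, b, c] [0, 1, 0 :: nat] \<longleftrightarrow> a < b \<and> c = a" for a b c :: 'a
    unfolding order_isomorphic_3 by auto
  moreover have "order_isomorphic [a, b, c] [1, 0, 2 :: nat] \<longleftrightarrow> b < a \<and> a < c" for a b c :: 'a
    unfolding order_isomorphic_3 by auto
  ultimately show ?thesis
    unfolding avoids_both_def avoids_pattern_def contains_pattern_3 by blast
qed

lemma subseq_set: "subseq xs ys \<Longrightarrow> set xs \<subseteq> set ys"
  by (auto simp: subseq_conv_nths dest: in_set_nthsD)

lemma subseq_2_append:
  "subseq [a, b] (u @ v) \<longleftrightarrow>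
     subseq [a, b] u \<or> a \<in> set u \<and> b \<in> set v \<or> subseq [a, b] v"
  by (induction u) (auto simp: subseq_singleton_left dest: subseq_set)

text \<open>The four disjuncts record whether three, two, one or none of the letters are taken from
  \<open>u\<close>.\<close>

lemma subseq_3_append:
  "subseq [a, b, c] (u @ v) \<longleftrightarrow>
     subseq [a, b, c] u \<or> subseq [a, b] u \<and> c \<in> set v \<or>
     a \<in> set u \<and> subseq [b, c] v \<or> subseq [a, b, c] v"
  by (induction u)
    (auto simp: subseq_singleton_left subseq_2_append dest: subseq_set subseq_Cons')

section \<open>Closure of avoidance under subsequences, concatenation and increasing maps\<close>

lemma avoids_both_subseq: "subseq u w \<Longrightarrow> avoids_both w \<Longrightarrow> avoids_both u"
  unfolding avoids_both_def using subseq_order.trans by blast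

lemma avoids_bothD:
  assumes "avoids_both w" "subseq [a, b, c] w"
  shows "a < b \<Longrightarrow> c \<noteq> a" "b < a \<Longrightarrow> c \<le> a"
  using assms unfolding avoids_both_def by (blast, meson not_less)

text \<open>A triple that lies in neither factor starts in \<open>u\<close> and ends in
  \<open>v\<close>, with its middle letter in either. The third assumption forgets positions and
  looks at letters only; this sufficient condition holds for all the block decompositions
  below.\<close>

lemma avoids_both_append:
  assumes "avoids_both u" "avoids_both v"
    and "\<And>a b c. a \<in> set u \<Longrightarrow> b \<in> set u \<union> set v \<Longrightarrow> c \<in> set v \<Longrightarrow>
      \<not> (a < b \<and> c = a) \<and> \<not> (b < a \<and> a < c)"
  shows "avoids_both (u @ v)"
  unfolding avoids_both_def
proof (intro allI impI)
  fix a b c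
  assume "subseq [a, b, c] (u @ v)"
  then consider "subseq [a, b, c] u" | "subseq [a, b, c] v"
    | "a \<in> set u" "b \<in> set u \<union> set v" "c \<in> set v"
    unfolding subseq_3_append using subseq_set[of "[a, b]" u] subseq_set[of "[b, c]" v] by auto
  then show "\<not> (a < b \<and> c = a) \<and> \<not> (b < a \<and> a < c)"
    using assms unfolding avoids_both_def by cases blast+
qed

text \<open>A crossing triple has \<open>c < a\<close>, whereas 010 needs \<open>c = a\<close> and
  102 needs \<open>a < c\<close>.\<close>

lemma avoids_both_append_below:
  assumes "avoids_both u" "avoids_both v" "\<And>x y. x \<in> set u \<Longrightarrow> y \<in> set v \<Longrightarrow> y < x"
  shows "avoids_both (u @ v)"
  using assms(1,2) by (rule avoids_both_append) (use assms(3) in \<open>auto dest: less_asym\<close>)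

lemma avoids_both_replicate: "avoids_both (replicate k x)"
proof -
  have "a = x \<and> b = x" if "subseq [a, b, c] (replicate k x)" for a b c
    using subseq_set[OF that] by auto
  then show ?thesis
    unfolding avoids_both_def by blast
qed

text \<open>A crossing triple starts with the maximum \<open>x\<close>, but in both patterns some
  letter exceeds the first one.\<close>

lemma avoids_both_replicate_max:
  assumes "avoids_both v" "\<And>y. y \<in> set v \<Longrightarrow> y \<le> x"
  shows "avoids_both (replicate k x @ v)"
  using avoids_both_replicate assms(1)
  by (rule avoids_both_append) (use assms(2) in \<open>auto dest: leD\<close>)

text \<open>A crossing triple starts with the minimum \<open>x\<close> and ends strictly above it:
  the former excludes 102, the latter 010.\<close>

lemma avoids_both_replicate_below:
  assumes "avoids_both v" "\<And>y. y \<in> set v \<Longrightarrow> x < y"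
  shows "avoids_both (replicate k x @ v)"
  using avoids_both_replicate assms(1)
  by (rule avoids_both_append) (use assms(2) in \<open>auto dest: less_asym\<close>)

lemma avoids_both_map:
  assumes "strict_mono f"
  shows "avoids_both (map f w) \<longleftrightarrow> avoids_both w"
proof -
  note f_simps = strict_mono_less[OF assms] strict_mono_eq[OF assms]
  show ?thesis
  proof
    assume w: "avoids_both (map f w)"
    show "avoids_both w"
      unfolding avoids_both_def
    proof (intro allI impI)
      fix a b c assume "subseq [a, b, c] w"
      then have "subseq [f a, f b, f c] (map f w)"
        using subseq_map[of "[a, b, c]" w f] by simp
      from avoids_bothD[OF w this] show "\<not> (a < b \<and> c = a) \<and> \<not> (b < a \<and> a < c)"
        by (auto simp: f_simps not_less[symmetric])
    qed
  next
    assume w: "avoids_both w"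
    show "avoids_both (map f w)"
      unfolding avoids_both_def
    proof (intro allI impI)
      fix a b c assume "subseq [a, b, c] (map f w)"
      \<comment> \<open>The positions \<open>N\<close> of the triple in the image also select its
        preimage in \<open>w\<close>.\<close>
      then obtain N where "[a, b, c] = map f (nths w N)"
        unfolding subseq_conv_nths nths_map by (elim exE)
      then obtain x y z where xyz: "nths w N = [x, y, z]" "a = f x" "b = f y" "c = f z"
        by (auto simp: Cons_eq_map_conv)
      then have "subseq [x, y, z] w"
        unfolding subseq_conv_nths by metis
      from avoids_bothD[OF w this] show "\<not> (a < b \<and> c = a) \<and> \<not> (b < a \<and> a < c)"
        by (auto simp: f_simps xyz not_less[symmetric])
    qed
  qed
qed

lemma strict_mono_plus: "strict_mono (\<lambda>x. x + k :: nat)"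
  by (simp add: strict_mono_def)

section \<open>Shifted inversion sequences under concatenation and translation\<close>

lemma mem_shifted_iff:
  "\<sigma> \<in> shifted_inversion_sequences n s \<longleftrightarrow>
     length \<sigma> = n \<and> (\<forall>i<n. int (\<sigma> ! i) \<le> int i + s)"
proof -
  have "{1..n} = Suc ` {..<n}"
    by (simp add: image_Suc_lessThan)
  \<comment> \<open>Passing to zero-based positions turns the strict bound into a weak one with the
    same \<open>s\<close>.\<close>
  moreover have "int a < int (Suc i) + s \<longleftrightarrow> int a \<le> int i + s" for a i
    by auto
  ultimately show ?thesis
    by (simp add: shifted_inversion_sequences_def lessThan_def del: of_nat_Suc)
qed

text \<open>The letters of \<open>v\<close> stand \<open>length u\<close> places further right,
  which raises their shift by that amount.\<close>

lemma append_mem_shifted_iff: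
  "u @ v \<in> shifted_inversion_sequences n s \<longleftrightarrow>
     length u + length v = n \<and>
     u \<in> shifted_inversion_sequences (length u) s \<and>
     v \<in> shifted_inversion_sequences (length v) (s + int (length u))"
proof -
  have "(\<forall>i<length u + length v. int ((u @ v) ! i) \<le> int i + s) \<longleftrightarrow>
    (\<forall>i<length u. int (u ! i) \<le> int i + s) \<and>
    (\<forall>i<length v. int (v ! i) \<le> int i + (s + int (length u)))" (is "?L \<longleftrightarrow> ?R")
  proof
    assume ?L
    then show ?R
    proof (intro conjI allI impI)
      show "int (u ! i) \<le> int i + s" if "i < length u" for i
        using \<open>?L\<close>[rule_format, of i] that by (simp add: nth_append)
      show "int (v ! i) \<le> int i + (s + int (length u))" if "i < length v" for i
        using \<open>?L\<close>[rule_format, of "length u + i"] that by (simp add: nth_append algebra_simps)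
    qed
  next
    assume ?R
    show ?L
    proof (intro allI impI)
      fix i assume "i < length u + length v"
      then show "int ((u @ v) ! i) \<le> int i + s"
        using \<open>?R\<close>[THEN conjunct1, rule_format, of i]
              \<open>?R\<close>[THEN conjunct2, rule_format, of "i - length u"]
        by (auto simp: nth_append)
    qed
  qed
  then show ?thesis
    by (auto simp: mem_shifted_iff)
qed

lemma map_plus_mem_shifted_iff:
  "map (\<lambda>x. x + k) u \<in> shifted_inversion_sequences n s \<longleftrightarrow>
     u \<in> shifted_inversion_sequences n (s - int k)"
  by (auto simp: mem_shifted_iff algebra_simps)

text \<open>The bound is tightest at the first position, where it equals \<open>s\<close>.\<close>

lemma shifted_inversion_sequences_bounded:
  assumes "\<And>x. x \<in> set u \<Longrightarrow> int x \<le> s"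
  shows "u \<in> shifted_inversion_sequences (length u) s"
  unfolding mem_shifted_iff using assms[OF nth_mem] by (auto intro: add_increasing)

lemma finite_shifted: "finite (shifted_inversion_sequences n s)"
proof (rule finite_subset)
  show "shifted_inversion_sequences n s \<subseteq> {u. set u \<subseteq> {..nat (int n + s)} \<and> length u = n}"
    by (fastforce simp: mem_shifted_iff in_set_conv_nth)
  show "finite {u. set u \<subseteq> {..nat (int n + s)} \<and> length u = n}"
    by (rule finite_lists_length_eq) simp
qed

section \<open>The sets counted by \<open>\<aa>\<close> and \<open>\<bb>\<close>\<close>

definition avoiders :: "nat \<Rightarrow> int \<Rightarrow> nat list set" where
  "avoiders n s = {u \<in> shifted_inversion_sequences n s. avoids_both u}"

text \<open>Stating the maximum through \<open>Suc\<close> needs no integers and already implies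
  that all letters are below \<open>m\<close>. In the decomposition \<open>v\<close> is a positive
  word lowered by 1, so \<open>m\<close> is the maximum before lowering.\<close>

definition words_max :: "nat \<Rightarrow> nat \<Rightarrow> nat list set" where
  "words_max n m = {v. length v = n \<and> v \<noteq> [] \<and> Suc (Max (set v)) = m \<and> avoids_both v}"

lemma card_avoiders: "card (avoiders n s) = \<aa> n s"
  by (simp add: avoiders_def \<aa>_def avoids_both_iff)

lemma card_words_max: "card (words_max n m) = \<bb> n m"
proof -
  have "set v \<subseteq> {0..<m} \<and> v \<noteq> [] \<and> int (Max (set v)) = int m - 1 \<longleftrightarrow>
      v \<noteq> [] \<and> Suc (Max (set v)) = m" for v :: "nat list"
    by (auto simp: less_Suc_eq_le)
  then show ?thesis
    unfolding words_max_def \<bb>_def avoids_both_iff by (intro arg_cong[where f = card]) blast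
qed

lemma finite_avoiders: "finite (avoiders n s)"
  by (simp add: avoiders_def finite_shifted)

lemma finite_words_max: "finite (words_max n m)"
proof (rule finite_subset)
  show "words_max n m \<subseteq> {v. set v \<subseteq> {..m} \<and> length v = n}"
    by (auto simp: words_max_def intro: le_SucI)
  show "finite {v. set v \<subseteq> {..m} \<and> length v = n}"
    by (rule finite_lists_length_eq) simp
qed

lemma length_avoiders: "u \<in> avoiders n s \<Longrightarrow> length u = n"
  by (simp add: avoiders_def mem_shifted_iff)

section \<open>Normal forms by the place of the zeros, and their unique readability\<close>

lemma append_split_unique:
  assumes "xs @ ys = xs' @ ys'"
    and "\<forall>x\<in>set xs. P x" "\<forall>x\<in>set xs'. P x"
    and "ys = [] \<or> \<not> P (hd ys)" "ys' = [] \<or> \<not> P (hd ys')"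
  shows "xs = xs'" "ys = ys'"
proof -
  \<comment> \<open>The boundary is the first letter failing \<open>P\<close>, so the left factor
    can be recovered from the whole list.\<close>
  have "takeWhile P (xs @ ys) = xs" "takeWhile P (xs' @ ys') = xs'"
    using assms(2-) by (auto simp: takeWhile_append takeWhile_eq_Nil_iff)
  with assms(1) show "xs = xs'" "ys = ys'" by auto
qed

definition zeros_first :: "nat \<Rightarrow> nat list \<Rightarrow> nat list" where
  "zeros_first z u = replicate z 0 @ map Suc u"

definition zeros_last :: "nat \<Rightarrow> nat list \<Rightarrow> nat list" where
  "zeros_last z u = map Suc u @ replicate z 0"

definition zeros_middle :: "nat list \<Rightarrow> nat \<Rightarrow> nat \<Rightarrow> nat \<Rightarrow> nat list \<Rightarrow> nat list" where
  "zeros_middle u m j z v =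
     map (\<lambda>x. x + Suc m) u @ replicate j m @ replicate z 0 @ map Suc v"

lemma zeros_first_inject:
  "zeros_first z u = zeros_first z' u' \<longleftrightarrow> z = z' \<and> u = u'"
proof
  assume *: "zeros_first z u = zeros_first z' u'"
  have hd: "map Suc u = [] \<or> hd (map Suc u) \<noteq> 0" for u
    by (cases u) auto
  have "replicate z 0 = replicate z' (0 :: nat)" "map Suc u = map Suc u'"
    by (rule append_split_unique[where P = "\<lambda>x. x = 0", OF *[unfolded zeros_first_def]];
        (rule hd | simp))+
  then show "z = z' \<and> u = u'"
    by (simp add: inj_map_eq_map)
qed auto

lemma zeros_last_inject:
  "zeros_last z u = zeros_last z' u' \<longleftrightarrow> z = z' \<and> u = u'"
proof
  assume *: "zeros_last z u = zeros_last z' u'"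
  have hd: "replicate z 0 = [] \<or> \<not> hd (replicate z 0) \<noteq> (0 :: nat)" for z
    by (cases z) auto
  have "map Suc u = map Suc u'" "replicate z 0 = replicate z' (0 :: nat)"
    by (rule append_split_unique[where P = "\<lambda>x. x \<noteq> 0", OF *[unfolded zeros_last_def]];
        (rule hd | simp))+
  then show "z = z' \<and> u = u'"
    by (simp add: inj_map_eq_map)
qed auto

text \<open>Two cuts recover the parameters. The first zero, which exists because
  \<open>z > 0\<close> and is not preceded by any since \<open>m > 0\<close>, separates off
  \<open>zeros_first z v\<close>; this yields \<open>z\<close>, \<open>v\<close> and hence
  \<open>m\<close>. In the prefix, the first letter not exceeding \<open>m\<close> then separates
  \<open>u\<close> from the copies of \<open>m\<close>.\<close>

lemma zeros_middle_inject:
  assumes eq: "zeros_middle u m j z v = zeros_middle u' m' j' z' v'"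
    and pos: "z > 0" "z' > 0"
    and m: "m = Suc (Max (set v))" "m' = Suc (Max (set v'))"
  shows "u = u' \<and> m = m' \<and> j = j' \<and> z = z' \<and> v = v'"
proof -
  have *: "(map (\<lambda>x. x + Suc m) u @ replicate j m) @ zeros_first z v =
      (map (\<lambda>x. x + Suc m') u' @ replicate j' m') @ zeros_first z' v'"
    using eq by (simp add: zeros_middle_def zeros_first_def)
  have hd: "zeros_first z v = [] \<or> \<not> hd (zeros_first z v) \<noteq> 0" if "z > 0" for z v
    using that by (simp add: zeros_first_def hd_append)
  have 1: "map (\<lambda>x. x + Suc m) u @ replicate j m = map (\<lambda>x. x + Suc m') u' @ replicate j' m'"
    and "zeros_first z v = zeros_first z' v'"
    by (rule append_split_unique[where P = "\<lambda>x. x \<noteq> 0", OF *];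
        (rule hd[OF pos(1)] | rule hd[OF pos(2)] | use m in force))+
  then have [simp]: "z = z'" "v = v'" "m = m'"
    using m by (auto simp: zeros_first_inject)
  have hd: "replicate j m = [] \<or> \<not> hd (replicate j m) > m" for j
    by (cases j) auto
  have "map (\<lambda>x. x + Suc m) u = map (\<lambda>x. x + Suc m) u'" "replicate j m = replicate j' m"
    by (rule append_split_unique[where P = "\<lambda>x. x > m", OF 1[folded \<open>m = m'\<close>]];
        (rule hd | force))+
  moreover have "inj (\<lambda>x. x + Suc m)"
    by (simp add: inj_def)
  ultimately show ?thesis
    by (simp add: inj_map_eq_map)
qed

section \<open>When a normal form is an avoiding shifted inversion sequence\<close>

lemma replicate_mem_shifted:
  "int x \<le> s \<Longrightarrow> replicate k x \<in> shifted_inversion_sequences k s"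
  using shifted_inversion_sequences_bounded[of "replicate k x" s] by auto

lemma avoids_both_map_Suc: "avoids_both (map Suc u) \<longleftrightarrow> avoids_both u"
  using avoids_both_map[OF strict_mono_plus[of 1]] by simp

lemma map_Suc_mem_shifted_iff:
  "map Suc u \<in> shifted_inversion_sequences n s \<longleftrightarrow> u \<in> shifted_inversion_sequences n (s - 1)"
  using map_plus_mem_shifted_iff[of 1] by simp

text \<open>Skipping \<open>z\<close> positions raises the shift by \<open>z\<close>, and lowering
  the positive letters reduces it by 1. The zeros lie below all later letters, so they create no
  pattern.\<close>

lemma zeros_first_mem_avoiders:
  assumes "s \<ge> 0"
  shows "zeros_first z u \<in> avoiders n s \<longleftrightarrow> z \<le> n \<and> u \<in> avoiders (n - z) (s + int z - 1)"
proof -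
  have "avoids_both (zeros_first z u) \<longleftrightarrow> avoids_both u"
    using avoids_both_replicate_below[of "map Suc u" 0 z]
      avoids_both_subseq[of "map Suc u" "zeros_first z u"]
    by (auto simp: zeros_first_def avoids_both_map_Suc)
  moreover have "zeros_first z u \<in> shifted_inversion_sequences n s \<longleftrightarrow>
      z \<le> n \<and> u \<in> shifted_inversion_sequences (n - z) (s + int z - 1)"
    unfolding zeros_first_def append_mem_shifted_iff
    using assms replicate_mem_shifted[of 0 s z]
    by (auto simp: map_Suc_mem_shifted_iff) (auto simp: mem_shifted_iff)
  ultimately show ?thesis
    by (auto simp: avoiders_def)
qed

text \<open>The positive prefix keeps its positions, so only the lowering by 1 changes the shift;
  for \<open>s = 0\<close> this is where the shift \<open>-1\<close> arises.\<close>

lemma zeros_last_mem_avoiders: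
  assumes "s \<ge> 0"
  shows "zeros_last z u \<in> avoiders n s \<longleftrightarrow> z \<le> n \<and> u \<in> avoiders (n - z) (s - 1)"
proof -
  have "avoids_both (zeros_last z u) \<longleftrightarrow> avoids_both u"
    using avoids_both_append_below[of "map Suc u" "replicate z 0"] avoids_both_replicate[of z 0]
      avoids_both_subseq[of "map Suc u" "zeros_last z u"]
    by (auto simp: zeros_last_def avoids_both_map_Suc)
  moreover have "zeros_last z u \<in> shifted_inversion_sequences n s \<longleftrightarrow>
      z \<le> n \<and> u \<in> shifted_inversion_sequences (n - z) (s - 1)"
    unfolding zeros_last_def append_mem_shifted_iff
    using assms replicate_mem_shifted[of 0 "s + int (length u)" z]
    by (auto simp: map_Suc_mem_shifted_iff) (auto simp: mem_shifted_iff)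
  ultimately show ?thesis
    by (auto simp: avoiders_def)
qed

lemma words_maxD:
  assumes "v \<in> words_max r m"
  shows "length v = r" "v \<noteq> []" "avoids_both v" "m = Suc (Max (set v))"
    "x \<in> set v \<Longrightarrow> x < m"
  using assms by (auto simp: words_max_def less_Suc_eq_le)

text \<open>All letters after the \<open>u\<close> block are at most \<open>m \<le> s\<close> and
  thus satisfy the position bounds automatically. This is why the tail is counted by the unshifted
  numbers \<open>\<bb>\<close> and only \<open>u\<close> carries a shift. Avoidance is built up from
  right to left, block by block.\<close>

lemma zeros_middle_mem_avoiders:
  assumes v: "v \<in> words_max r m" and u: "u \<in> avoiders l (int s - int m - 1)"
    and "m \<le> s" "n = l + j + z + r"
  shows "zeros_middle u m j z v \<in> avoiders n (int s)"
proof -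
  note v = words_maxD[OF v]
  have "avoids_both (map (\<lambda>x. x + Suc m) u)"
    using u by (simp add: avoids_both_map[OF strict_mono_plus] avoiders_def del: add_Suc_right)
  moreover have "avoids_both (replicate z 0 @ map Suc v)"
    by (rule avoids_both_replicate_below) (use v in \<open>auto simp: avoids_both_map_Suc\<close>)
  then have "avoids_both (replicate j m @ replicate z 0 @ map Suc v)"
    by (rule avoids_both_replicate_max) (auto dest: v(5) simp: Suc_le_eq)
  ultimately have 1: "avoids_both (zeros_middle u m j z v)"
    unfolding zeros_middle_def
    by (rule avoids_both_append_below) (use v(4) in \<open>auto dest: v(5)\<close>)
  let ?w = "replicate j m @ replicate z 0 @ map Suc v"
  have "?w \<in> shifted_inversion_sequences (length ?w) (int s + int l)"
    using \<open>m \<le> s\<close> by (intro shifted_inversion_sequences_bounded) (auto dest!: v(5))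
  moreover have "map (\<lambda>x. x + Suc m) u \<in> shifted_inversion_sequences l (int s)"
    using u unfolding map_plus_mem_shifted_iff avoiders_def by (simp add: algebra_simps)
  ultimately have "zeros_middle u m j z v \<in> shifted_inversion_sequences n (int s)"
    unfolding zeros_middle_def append_mem_shifted_iff[of "map _ u"]
    using assms(4) v(1) length_avoiders[OF u] by simp
  with 1 show ?thesis
    by (simp add: avoiders_def)
qed

section \<open>Decomposition of an avoider around its zeros\<close>

lemma map_Suc_pred: "0 \<notin> set y \<Longrightarrow> map Suc (map (\<lambda>x. x - 1) y) = y"
  by (induction y) auto

text \<open>The word is cut before its first zero and after the run of zeros starting there; 010
  excludes any later zero. Words without zeros fall under \<open>first\<close> with
  \<open>z = 0\<close>.\<close>

lemma avoiders_zero_blocks: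
  assumes w: "avoids_both w"
  obtains (first) z u where "w = zeros_first z u"
    | (last) z u where "w = zeros_last z u" "z > 0" "u \<noteq> []"
    | (middle) x z y where "w = x @ replicate z 0 @ y" "x \<noteq> []" "z > 0" "y \<noteq> []"
        "0 \<notin> set x" "0 \<notin> set y"
proof -
  define x where "x = takeWhile (\<lambda>a. a \<noteq> 0) w"
  define w' where "w' = dropWhile (\<lambda>a. a \<noteq> 0) w"
  define z where "z = length (takeWhile (\<lambda>a. a = 0) w')"
  define y where "y = dropWhile (\<lambda>a. a = 0) w'"
  have "\<forall>a\<in>set (takeWhile (\<lambda>a. a = 0) w'). a = 0"
    by (auto dest: set_takeWhileD)
  then have "takeWhile (\<lambda>a. a = 0) w' = replicate z 0"
    unfolding z_def by (intro replicate_length_same[symmetric])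
  then have w'_eq: "w' = replicate z 0 @ y"
    unfolding y_def using takeWhile_dropWhile_id[of "\<lambda>a. a = 0" w'] by simp
  then have w_eq: "w = x @ replicate z 0 @ y"
    unfolding x_def w'_def using takeWhile_dropWhile_id[of "\<lambda>a. a \<noteq> 0" w] by simp
  have x: "0 \<notin> set x"
    unfolding x_def by (auto dest: set_takeWhileD)
  have y_hd: "y \<noteq> [] \<Longrightarrow> hd y \<noteq> 0"
    unfolding y_def by (rule hd_dropWhile)
  \<comment> \<open>With an empty run, \<open>y\<close> would be the part of \<open>w\<close> from
    its first zero on, yet its head is nonzero.\<close>
  have z: "z > 0" if "y \<noteq> []"
  proof (rule ccontr)
    assume "\<not> z > 0"
    then have "y = w'"
      by (simp add: w'_eq)
    with that y_hd show False
      using hd_dropWhile[of "\<lambda>a. a \<noteq> 0" w] unfolding w'_def by blast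
  qed
  have y: "0 \<notin> set y"
  proof
    assume "0 \<in> set y"
    \<comment> \<open>A zero of the run, the positive head \<open>b\<close> of \<open>y\<close> and
      the later zero form 010.\<close>
    then obtain b t where "y = b # t" "0 \<in> set t" "b > 0" "z > 0"
      using y_hd z by (cases y) auto
    then have "subseq ([] @ [0] @ [b, 0]) w"
      unfolding w_eq
      by (intro list_emb_append_mono) (auto simp: subseq_singleton_left)
    then show False
      using avoids_bothD(1)[OF w, of 0 b 0] \<open>b > 0\<close> by simp
  qed
  consider "x = []" | "x \<noteq> []" "y = []" "z = 0" | "x \<noteq> []" "y = []" "z > 0" | "x \<noteq> []" "y \<noteq> []"
    by blast
  then show thesis
  proof cases
    case 1
    then show thesis
      using map_Suc_pred[OF y] w_eq by (intro first[of z "map (\<lambda>x. x - 1) y"]) (simp add: zeros_first_def)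
  next
    case 2
    then show thesis
      using map_Suc_pred[OF x] w_eq by (intro first[of 0 "map (\<lambda>x. x - 1) x"]) (simp add: zeros_first_def)
  next
    case 3
    then show thesis
      using map_Suc_pred[OF x] w_eq
      by (intro last[of z "map (\<lambda>x. x - 1) x"]) (simp_all add: zeros_last_def)
  next
    case 4
    show thesis
      by (rule middle[OF w_eq \<open>x \<noteq> []\<close> z[OF \<open>y \<noteq> []\<close>] \<open>y \<noteq> []\<close> x y])
  qed
qed

text \<open>With \<open>m\<close> the maximum of \<open>y\<close>, the prefix \<open>x\<close> is
  cut at its first letter not exceeding \<open>m\<close>. The lemma shows that everything from there
  to the zeros equals \<open>m\<close>.\<close>

lemma interior_zeros_middle:
  assumes w: "x @ replicate z 0 @ y \<in> avoiders n (int s)"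
    and x: "x \<noteq> []" "0 \<notin> set x" and y: "y \<noteq> []" "0 \<notin> set y" and z: "z > 0"
  obtains u m j v where "x @ replicate z 0 @ y = zeros_middle u m j z v"
    "v \<in> words_max (length y) m" "m \<le> s" "u \<in> avoiders (length u) (int s - int m - 1)"
    "length x = length u + j"
proof -
  let ?w = "x @ replicate z 0 @ y"
  define m where "m = Max (set y)"
  define v where "v = map (\<lambda>x. x - 1) y"
  define u' where "u' = takeWhile (\<lambda>a. a > m) x"
  define x' where "x' = dropWhile (\<lambda>a. a > m) x"
  define u where "u = map (\<lambda>x. x - Suc m) u'"
  define j where "j = length x'"
  have av: "avoids_both ?w" and sh: "?w \<in> shifted_inversion_sequences n (int s)"
    using w by (auto simp: avoiders_def)
  have y_eq: "y = map Suc v"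
    using map_Suc_pred[OF y(2)] by (simp add: v_def)
  have m_in: "m \<in> set y"
    using y by (simp add: m_def)
  have "m > 0"
    using m_in y(2) by (metis neq0_conv)
  have m_le: "m \<le> a" if "a \<in> set x" for a
  proof -
    \<comment> \<open>If \<open>a < m\<close>, this triple would be an occurrence of 102.\<close>
    have "subseq ([a] @ [0] @ [m]) ?w"
      by (intro list_emb_append_mono) (use that z m_in in \<open>auto simp: subseq_singleton_left\<close>)
    moreover have "a > 0"
      using that x(2) by (metis neq0_conv)
    ultimately show ?thesis
      using avoids_bothD(2)[OF av, of a 0 m] by simp
  qed
  have x_eq: "x = u' @ x'"
    by (simp add: u'_def x'_def)
  have "a = m" if a: "a \<in> set x'" for a
  proof -
    obtain b t where bt: "x' = b # t"
      using a by (cases x') auto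
    then have "\<not> b > m"
      using hd_dropWhile[of "\<lambda>a. a > m" x] unfolding x'_def by simp
    moreover have "m \<le> b"
      using m_le[of b] unfolding x_eq bt by simp
    ultimately have t: "x' = m # t"
      using bt by simp
    show ?thesis
    proof (cases "a \<in> set t")
      case True
      \<comment> \<open>The final \<open>m\<close> comes from \<open>y\<close>, so
        \<open>a > m\<close> would complete an occurrence of 010.\<close>
      then have "subseq ([] @ [m, a] @ [] @ [m]) (u' @ x' @ replicate z 0 @ y)"
        by (intro list_emb_append_mono) (use t m_in in \<open>auto simp: subseq_singleton_left\<close>)
      then have "subseq [m, a, m] ?w"
        by (simp add: x_eq)
      then have "\<not> m < a"
        using avoids_bothD(1)[OF av, of m a m] by blast
      moreover have "m \<le> a"
        using m_le[of a] a unfolding x_eq by simp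
      ultimately show ?thesis
        by simp
    qed (use a t in auto)
  qed
  then have x'_eq: "x' = replicate j m"
    unfolding j_def by (intro replicate_length_same[symmetric]) blast
  have "m < a" if "a \<in> set u'" for a
    using that unfolding u'_def by (auto dest: set_takeWhileD)
  then have u'_eq: "u' = map (\<lambda>x. x + Suc m) u"
    unfolding u_def map_map by (intro map_idI[symmetric]) (simp add: Suc_le_eq del: add_Suc_right)
  have eq: "?w = zeros_middle u m j z v"
    unfolding zeros_middle_def x_eq u'_eq[symmetric] x'_eq[symmetric] y_eq[symmetric] by simp
  have "Max (Suc ` set v) = Suc (Max (set v))"
    using y(1) y_eq by (intro mono_Max_commute[symmetric]) (auto simp: mono_def)
  then have "Suc (Max (set v)) = m"
    unfolding m_def by (subst y_eq) simp
  moreover have "avoids_both (map Suc v)"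
    unfolding y_eq[symmetric] by (intro avoids_both_subseq[OF _ av] subseq_drop_many) simp
  ultimately have "v \<in> words_max (length y) m"
    using y(1) unfolding words_max_def avoids_both_map_Suc by (simp add: v_def)
  moreover have "m \<le> s"
  proof -
    \<comment> \<open>The first letter belongs to \<open>x\<close>, hence is at least
      \<open>m\<close>, while the bound at position 0 is \<open>s\<close>.\<close>
    have "int (?w ! 0) \<le> int 0 + int s"
      using sh x by (auto simp: mem_shifted_iff)
    moreover have "m \<le> ?w ! 0"
      using m_le[of "x ! 0"] x by (simp add: nth_append)
    ultimately show ?thesis by simp
  qed
  moreover have "u \<in> avoiders (length u) (int s - int m - 1)"
  proof -
    have "avoids_both u'"
      by (rule avoids_both_subseq[OF _ av]) (simp add: x_eq subseq_rev_drop_many)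
    then have "avoids_both u"
      unfolding u'_eq by (simp add: avoids_both_map[OF strict_mono_plus] del: add_Suc_right)
    moreover have "u' \<in> shifted_inversion_sequences (length u') (int s)"
      using sh unfolding x_eq by (simp add: append_mem_shifted_iff)
    then have "u \<in> shifted_inversion_sequences (length u) (int s - int m - 1)"
      unfolding u'_eq map_plus_mem_shifted_iff by (simp add: algebra_simps)
    ultimately show ?thesis
      by (simp add: avoiders_def)
  qed
  ultimately show thesis
    using eq by (intro that[of u m j v]) (simp_all add: x_eq u_def j_def v_def)
qed

section \<open>The three families and their cardinalities\<close>

definition first_family :: "nat \<Rightarrow> nat \<Rightarrow> nat list set" where
  "first_family n s = (\<lambda>(z, u). zeros_first z u) `
     (SIGMA z:{0..n}. avoiders (n - z) (int s + int z - 1))"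

text \<open>The value \<open>z = n\<close> is left out because the all-zero word already belongs to
  \<open>first_family\<close>, and \<open>z = 0\<close> because words without zeros do.\<close>

definition last_family :: "nat \<Rightarrow> nat \<Rightarrow> nat list set" where
  "last_family n s = (\<lambda>(z, u). zeros_last z u) `
     (SIGMA z:{1..n - 1}. avoiders (n - z) (int s - 1))"

text \<open>The nesting follows the triple sum, with \<open>v\<close> before \<open>l\<close> so
  that \<open>\<bb> r m\<close> factors out. The number of zeros is not stored, being
  \<open>n - r - l - j\<close>; the upper bound on \<open>j\<close> makes it positive. Starting
  \<open>j\<close> at 1 when \<open>l = 0\<close> keeps the prefix nonempty and produces the
  Kronecker delta.\<close>

definition middle_index :: "nat \<Rightarrow> nat \<Rightarrow> (nat \<times> nat \<times> nat list \<times> nat \<times> nat \<times> nat list) set" where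
  "middle_index n s =
     (SIGMA r:{1..n - 2}. SIGMA m:{1..s}. SIGMA v:words_max r m. SIGMA l:{0..n - r - 1}.
      SIGMA j:{(if l = 0 then 1 else 0)..<n - r - l}. avoiders l (int s - int m - 1))"

definition middle_family :: "nat \<Rightarrow> nat \<Rightarrow> nat list set" where
  "middle_family n s =
     (\<lambda>(r, m, v, l, j, u). zeros_middle u m j (n - r - l - j) v) ` middle_index n s"

lemma card_first_family: "card (first_family n s) = (\<Sum>z = 0..n. \<aa> (n - z) (int s + int z - 1))"
proof -
  have "inj_on (\<lambda>(z, u). zeros_first z u) A" for A
    by (auto simp: inj_on_def zeros_first_inject)
  then show ?thesis
    unfolding first_family_def
    by (subst card_image) (simp_all add: card_SigmaI finite_avoiders card_avoiders)
qed

lemma card_last_family: "card (last_family n s) = (\<Sum>z = 1..n - 1. \<aa> (n - z) (int s - 1))"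
proof -
  have "inj_on (\<lambda>(z, u). zeros_last z u) A" for A
    by (auto simp: inj_on_def zeros_last_inject)
  then show ?thesis
    unfolding last_family_def
    by (subst card_image) (simp_all add: card_SigmaI finite_avoiders card_avoiders)
qed

text \<open>Unique readability gives \<open>u\<close>, \<open>m\<close>, \<open>j\<close> and
  \<open>v\<close>; the remaining components \<open>r\<close> and \<open>l\<close> are the lengths
  of \<open>v\<close> and \<open>u\<close>.\<close>

lemma inj_on_middle:
  "inj_on (\<lambda>(r, m, v, l, j, u). zeros_middle u m j (n - r - l - j) v) (middle_index n s)"
proof (rule inj_onI)
  fix p p'
  assume in_index: "p \<in> middle_index n s" "p' \<in> middle_index n s"
    and eq: "(\<lambda>(r, m, v, l, j, u). zeros_middle u m j (n - r - l - j) v) p =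
      (\<lambda>(r, m, v, l, j, u). zeros_middle u m j (n - r - l - j) v) p'"
  obtain r m v l j u where p: "p = (r, m, v, l, j, u)"
    by (cases p)
  obtain r' m' v' l' j' u' where p': "p' = (r', m', v', l', j', u')"
    by (cases p')
  have v: "v \<in> words_max r m" "v' \<in> words_max r' m'"
    and u: "u \<in> avoiders l (int s - int m - 1)" "u' \<in> avoiders l' (int s - int m' - 1)"
    and z: "n - r - l - j > 0" "n - r' - l' - j' > 0"
    using in_index by (auto simp: middle_index_def p p')
  have "zeros_middle u m j (n - r - l - j) v = zeros_middle u' m' j' (n - r' - l' - j') v'"
    using eq by (simp add: p p')
  from zeros_middle_inject[OF this z words_maxD(4)[OF v(1)] words_maxD(4)[OF v(2)]]
  show "p = p'"
    unfolding p p' using words_maxD(1)[OF v(1)] words_maxD(1)[OF v(2)] length_avoiders[OF u(1)] length_avoiders[OF u(2)]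
    by auto
qed

lemma card_middle_family:
  "int (card (middle_family n s)) =
     (\<Sum>r = 1..n - 2. \<Sum>m = 1..s. int (\<bb> r m) *
        (\<Sum>l = 0..n - r - 1.
          (int n - int r - int l - (if l = 0 then 1 else 0)) *
          int (\<aa> l (int s - int m - 1))))"
proof -
  have "card (middle_family n s) = card (middle_index n s)"
    unfolding middle_family_def by (rule card_image[OF inj_on_middle])
  also have "\<dots> = (\<Sum>r = 1..n - 2. \<Sum>m = 1..s. \<bb> r m *
        (\<Sum>l = 0..n - r - 1. (n - r - l - (if l = 0 then 1 else 0)) * \<aa> l (int s - int m - 1)))"
    unfolding middle_index_def
    by (simp add: card_SigmaI finite_words_max finite_avoiders card_avoiders card_words_max
        del: One_nat_def cong: sum.cong)
  finally have "int (card (middle_family n s)) = (\<Sum>r = 1..n - 2. \<Sum>m = 1..s. int (\<bb> r m) *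
        (\<Sum>l = 0..n - r - 1. int (n - r - l - (if l = 0 then 1 else 0)) *
          int (\<aa> l (int s - int m - 1))))"
    by simp
  \<comment> \<open>Within the summation ranges \<open>n - r - l\<close> is at least 1, so the
    truncated subtraction agrees with the integer one.\<close>
  also have "\<dots> = (\<Sum>r = 1..n - 2. \<Sum>m = 1..s. int (\<bb> r m) *
        (\<Sum>l = 0..n - r - 1. (int n - int r - int l - (if l = 0 then 1 else 0)) *
          int (\<aa> l (int s - int m - 1))))"
    by (intro sum.cong arg_cong2[where f = "(*)"] refl) auto
  finally show ?thesis .
qed

section \<open>The families exhaust the avoiders\<close>

lemma first_family_subset: "first_family n s \<subseteq> avoiders n (int s)"
  by (auto simp: first_family_def zeros_first_mem_avoiders)

lemma last_family_subset: "last_family n s \<subseteq> avoiders n (int s)"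
  by (auto simp: last_family_def zeros_last_mem_avoiders)

lemma middle_family_subset: "middle_family n s \<subseteq> avoiders n (int s)"
proof
  fix w assume "w \<in> middle_family n s"
  then obtain r m v l j u where "v \<in> words_max r m" "u \<in> avoiders l (int s - int m - 1)"
    "m \<le> s" "j < n - r - l" "w = zeros_middle u m j (n - r - l - j) v"
    by (auto simp: middle_family_def middle_index_def)
  then show "w \<in> avoiders n (int s)"
    by (auto intro: zeros_middle_mem_avoiders)
qed

lemma avoiders_eq_families:
  "avoiders n (int s) = first_family n s \<union> last_family n s \<union> middle_family n s"
proof
  show "first_family n s \<union> last_family n s \<union> middle_family n s \<subseteq> avoiders n (int s)"
    using first_family_subset last_family_subset middle_family_subset by blast
  show "avoiders n (int s) \<subseteq> first_family n s \<union> last_family n s \<union> middle_family n s"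
  proof
    fix w assume w: "w \<in> avoiders n (int s)"
    then have "avoids_both w" by (simp add: avoiders_def)
    then show "w \<in> first_family n s \<union> last_family n s \<union> middle_family n s"
    proof (cases rule: avoiders_zero_blocks)
      case (first z u)
      then have "w \<in> first_family n s"
        using w unfolding first_family_def
        by (intro image_eqI[of _ _ "(z, u)"]) (simp_all add: zeros_first_mem_avoiders)
      then show ?thesis by blast
    next
      case (last z u)
      then have "z \<le> n" and u: "u \<in> avoiders (n - z) (int s - 1)"
        using w by (simp_all add: zeros_last_mem_avoiders)
      moreover have "n - z \<noteq> 0"
        using length_avoiders[OF u] \<open>u \<noteq> []\<close> by auto
      ultimately have "w \<in> last_family n s"
        using last unfolding last_family_def
        by (intro image_eqI[of _ _ "(z, u)"]) simp_all
      then show ?thesis by blast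
    next
      case (middle x z y)
      obtain u m j v where *: "x @ replicate z 0 @ y = zeros_middle u m j z v"
        "v \<in> words_max (length y) m" "m \<le> s" "u \<in> avoiders (length u) (int s - int m - 1)"
        "length x = length u + j"
        by (rule interior_zeros_middle[OF w[unfolded middle(1)] middle(2,5,4,6,3)])
      have n: "n = length u + j + z + length y"
        using length_avoiders[OF w] middle(1) *(5) by simp
      have "m \<ge> 1"
        using words_maxD(4)[OF *(2)] by simp
      moreover have "length y \<ge> 1" "length x \<ge> 1"
        using middle(2,4) by (simp_all add: Suc_le_eq)
      \<comment> \<open>The prefix \<open>x\<close> and the zeros take at least two places, whence
        \<open>length y \<le> n - 2\<close>. Since \<open>x\<close> is nonempty,
        \<open>length u = 0\<close> forces \<open>j \<ge> 1\<close>, and \<open>z > 0\<close> gives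
        the strict upper bound on \<open>j\<close>.\<close>
      then have "length y \<in> {1..n - 2}" "length u \<in> {0..n - length y - 1}"
        "j \<in> {(if length u = 0 then 1 else 0)..<n - length y - length u}"
        unfolding atLeastAtMost_iff atLeastLessThan_iff using n *(5) \<open>z > 0\<close> by auto
      ultimately have "(length y, m, v, length u, j, u) \<in> middle_index n s"
        using *(2-4) by (simp add: middle_index_def)
      moreover have "w = zeros_middle u m j (n - length y - length u - j) v"
        unfolding middle(1) *(1) by (simp add: n)
      ultimately have "w \<in> middle_family n s"
        unfolding middle_family_def
        by (intro image_eqI[of _ _ "(length y, m, v, length u, j, u)"]) simp_all
      then show ?thesis by blast
    qed
  qed
qed

section \<open>Disjointness, read off from the end letters and the presence of zeros, and the final
  count\<close>

lemma first_family_zeros: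
  assumes "w \<in> first_family n s"
  shows "w = [] \<or> hd w = 0 \<or> 0 \<notin> set w"
proof -
  obtain z u where "w = zeros_first z u"
    using assms by (auto simp: first_family_def)
  then show ?thesis
    by (cases z) (auto simp: zeros_first_def)
qed

lemma last_family_zeros:
  assumes "w \<in> last_family n s"
  shows "w \<noteq> []" "hd w \<noteq> 0" "0 \<in> set w" "last w = 0"
proof -
  obtain z u where w: "w = zeros_last z u" "z \<in> {1..n - 1}" "u \<in> avoiders (n - z) (int s - 1)"
    using assms by (auto simp: last_family_def)
  then have "u \<noteq> []" "z > 0"
    using length_avoiders[OF w(3)] by auto
  then show "w \<noteq> []" "hd w \<noteq> 0" "0 \<in> set w" "last w = 0"
    by (auto simp: w(1) zeros_last_def hd_append hd_map)
qed

text \<open>The word ends in the nonempty block \<open>map Suc v\<close>, so its last letter is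
  positive; this distinguishes it from \<open>last_family\<close>. It begins with a letter above
  \<open>m\<close> or with \<open>m > 0\<close> itself.\<close>

lemma middle_family_zeros:
  assumes "w \<in> middle_family n s"
  shows "w \<noteq> []" "hd w \<noteq> 0" "0 \<in> set w" "last w \<noteq> 0"
proof -
  obtain r m v l j u where w: "w = zeros_middle u m j (n - r - l - j) v" "v \<in> words_max r m"
    "u \<in> avoiders l (int s - int m - 1)" "m > 0"
    "j \<in> {(if l = 0 then 1 else 0)..<n - r - l}"
    using assms unfolding middle_family_def middle_index_def by fastforce
  have "v \<noteq> []" "u \<noteq> [] \<or> j > 0" "j < n - r - l"
    using w words_maxD(2) length_avoiders[OF w(3)] by auto
  then show "w \<noteq> []" "hd w \<noteq> 0" "0 \<in> set w" "last w \<noteq> 0"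
    using w(4) by (auto simp: w(1) zeros_middle_def hd_append hd_map last_map)
qed

theorem theorem22:
  fixes n s :: nat
  assumes "n \<ge> 1"
  shows "int (\<aa> n (int s)) =
      (\<Sum>z = 0..n. int (\<aa> (n - z) (int s + int z - 1)))
    + (\<Sum>z = 1..n - 1. int (\<aa> (n - z) (int s - 1)))
    + (\<Sum>r = 1..n - 2. \<Sum>m = 1..s. int (\<bb> r m) *
        (\<Sum>l = 0..n - r - 1.
          (int n - int r - int l - (if l = 0 then 1 else 0)) *
          int (\<aa> l (int s - int m - 1))))"
proof -
  have fin: "finite (first_family n s)" "finite (last_family n s)" "finite (middle_family n s)"
    using finite_subset[OF first_family_subset finite_avoiders]
      finite_subset[OF last_family_subset finite_avoiders]
      finite_subset[OF middle_family_subset finite_avoiders] by auto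
  have "first_family n s \<inter> last_family n s = {}"
    using first_family_zeros last_family_zeros by blast
  moreover have "(first_family n s \<union> last_family n s) \<inter> middle_family n s = {}"
    using first_family_zeros last_family_zeros(4) middle_family_zeros by blast
  ultimately have "card (avoiders n (int s)) =
      card (first_family n s) + card (last_family n s) + card (middle_family n s)"
    using fin by (simp add: avoiders_eq_families card_Un_disjoint)
  then have "int (\<aa> n (int s)) =
      int (card (first_family n s)) + int (card (last_family n s)) + int (card (middle_family n s))"
    by (simp add: card_avoiders)
  then show ?thesis
    unfolding card_middle_family by (simp only: card_first_family card_last_family of_nat_sum)
qed

end
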